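(* Let $C\subseteq\mathbb{R}^n$ be convex with $D=\max_{\mathbf{x},\mathbf{y}\in C}\|\mathbf{x}-\mathbf{y}\|_2^2$, let $F$ be non-negative and differentiable on $C$ and $L$-smooth on $C$, and let $\mathbf{x}^*\in\operatorname{argmax}_{\mathbf{x}\in C}F(\mathbf{x})$ (assumed to exist). Let $T>0$, let $a,b:[0,T]\to\mathbb{R}$ be differentiable with $a_0>0$, $\dot a_t\ge0$, $b_0\ge 0$, $\dot b_t\ge 0$, and let $0=t_0<t_1<\dots<t_N=T$. Let $\mathbf{x}(t_0),\dots,\mathbf{x}(t_N)\in C$, and let $c_j>0$, $d_j\in\mathbb{R}$, $\mathbf{u}_j\in\mathbb{R}^n$ ($j=0,\dots,N-1$) satisfy, for all $j=0,\dots,N-1$: (i) $\|\mathbf{u}_j\|_2^2\le D$ and $F(\mathbf{x}^* )\le c_jF(\mathbf{x}(t_j))+d_j\langle\nabla F(\mathbf{x}(t_j)),\mathbf{u}_j\rangle$; (ii) $\mathbf{x}(t_{j+1})-\mathbf{x}(t_j)=\dfrac{b_{t_{j+1}}-b_{t_j}}{a_{t_{j+1}}}\,d_j\,\mathbf{u}_j$. Put $G_j=c_j(b_{t_{j+1}}-b_{t_j})-(a_{t_{j+1}}-a_{t_j})$ and $G_j^+=\max\{G_j,0\}$. Then $$F(\mathbf{x}(t_N))\ \ge\ \left(\frac{b_{t_N}-b_{t_0}-\sum_{j=0}^{N-1}G_j^{+}}{a_{t_N}}\right)F(\mathbf{x}^* )-\frac{DL}{2a_{t_N}}\sum_{j=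0}^{N-1}\frac{(b_{t_{j+1}}-b_{t_j})^2\,d_j^2}{a_{t_{j+1}}}.$$
   Context: $F$ is $L$-smooth on $C$ if $\|\nabla F(\mathbf{y})-\nabla F(\mathbf{x})\|_2\le L\|\mathbf{y}-\mathbf{x}\|_2$ for all $\mathbf{x},\mathbf{y}\in C$; on convex $C$ this gives $|F(\mathbf{y})-F(\mathbf{x})-\langle\nabla F(\mathbf{x}),\mathbf{y}-\mathbf{x}\rangle|\le\frac{L}{2}\|\mathbf{y}-\mathbf{x}\|_2^2$. The sequence $\mathbf{x}(t_j)$ is regarded as a discrete-time algorithm for $\max_{\mathbf{x}\in C}F(\mathbf{x})$ with output $\mathbf{x}(t_N)$. *)

theory Defs
  imports "HOL-Analysis.Analysis"
begin

text \<open>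
  The set \<open>C\<close> need not be open, so the derivative is taken within \<open>C\<close>. Where \<open>C\<close> has empty
  interior such a gradient is not unique, hence the gradient field is an explicit argument.
  If \<open>F\<close> is differentiable in a neighbourhood of \<open>C\<close>, its usual gradient is an instance.
\<close>
definition has_gradient_on ::
    "('a::real_inner \<Rightarrow> real) \<Rightarrow> ('a \<Rightarrow> 'a) \<Rightarrow> 'a set \<Rightarrow> bool" where
  "has_gradient_on F g C \<longleftrightarrow>
     (\<forall>x\<in>C. (F has_derivative (\<lambda>h. g x \<bullet> h)) (at x within C))"

definition L_smooth_on ::
    "real \<Rightarrow> ('a::real_inner \<Rightarrow> real) \<Rightarrow> ('a \<Rightarrow> 'a) \<Rightarrow> 'a set \<Rightarrow> bool" where
  "L_smooth_on L F g C \<longleftrightarrow> has_gradient_on F g C \<and>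
     (\<forall>x\<in>C. \<forall>y\<in>C. norm (g y - g x) \<le> L * norm (y - x))"

text \<open>The maximum is required to be attained; the library's \<open>Max\<close> is meant for finite sets.\<close>
definition is_max :: "real \<Rightarrow> real set \<Rightarrow> bool" where
  "is_max m S \<longleftrightarrow> m \<in> S \<and> (\<forall>s\<in>S. s \<le> m)"

end

(* The weighted values a(t_j) F(x(t_j)) are a discrete Lyapunov function. Smoothness bounds
   F(x(t_(j+1))) - F(x(t_j)) from below by its linear part minus a quadratic error, the linear part
   is bounded by hypothesis (i), and 0 <= F(x(t_j)) <= F(xstar) replaces G_j F(x(t_j)) by
   max(G_j, 0) F(xstar). The claim is the telescoped sum of these one-step bounds. *)
theory Submission
  imports Defs
begin

text \<open>Mean value theorem on \<open>{r..s}\<close>. Derivatives within \<open>{p..q}\<close>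
  are one-sided at the end points, which suits both the weights on \<open>{0..T}\<close> and the
  segment function in the next lemma.\<close>

lemma nondecreasing_if_deriv_nonneg_within:
  fixes f f' :: "real \<Rightarrow> real"
  assumes deriv: "\<And>s. s \<in> {p..q} \<Longrightarrow> (f has_real_derivative f' s) (at s within {p..q})"
    and nonneg: "\<And>s. s \<in> {p..q} \<Longrightarrow> 0 \<le> f' s"
    and "r \<in> {p..q}" "s \<in> {p..q}" "r \<le> s"
  shows "f r \<le> f s"
proof (cases "r = s")
  case False
  then have "r < s" using assms by simp
  have sub: "{r..s} \<subseteq> {p..q}" using assms by auto
  have "(f has_derivative (*) (f' z)) (at z within {r..s})" if "r \<le> z" "z \<le> s" for z
    using has_field_derivative_subset[OF deriv sub] sub that
    by (auto simp: has_field_derivative_def)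
  from mvt_simple[OF \<open>r < s\<close> this] obtain z where "z \<in> {r<..<s}" "f s - f r = f' z * (s - r)"
    by auto
  moreover from this have "0 \<le> f' z" using nonneg sub by auto
  ultimately have "0 \<le> f s - f r" using \<open>r < s\<close> by simp
  then show ?thesis by simp
qed simp

text \<open>Lower half of the descent lemma. Instead of integrating the gradient along the segment
  from \<open>y\<close> to \<open>z\<close>, the proof corrects \<open>F\<close> by the linear and
  quadratic terms and shows that the result is nondecreasing there.\<close>

lemma L_smooth_on_lower_bound:
  fixes F :: "'a::real_inner \<Rightarrow> real"
  assumes conv: "convex C" and smooth: "L_smooth_on L F g C"
    and y: "y \<in> C" and z: "z \<in> C"
  shows "F z \<ge> F y + g y \<bullet> (z - y) - L / 2 * (norm (z - y))\<^sup>2"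
proof -
  define v where "v = z - y"
  \<comment> \<open>Chosen so that \<open>h 0 \<le> h 1\<close> is the claim: \<open>h 0\<close> is
    \<open>F y\<close>, and \<open>h 1\<close> is \<open>F z\<close> minus the linear part plus the
    quadratic error.\<close>
  define h where "h = (\<lambda>s. F (y + s *\<^sub>R v) - s * (g y \<bullet> v) + L / 2 * s\<^sup>2 * (norm v)\<^sup>2)"
  define h' where "h' = (\<lambda>s. g (y + s *\<^sub>R v) \<bullet> v - g y \<bullet> v + L * s * (norm v)\<^sup>2)"
  have seg: "y + s *\<^sub>R v \<in> C" if "s \<in> {0..1}" for s
    using convexD_alt[OF conv y z, of s] that by (simp add: v_def algebra_simps)
  have deriv: "(h has_real_derivative h' s) (at s within {0..1})" if s: "s \<in> {0..1}" for s
  proof -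
    have "(F has_derivative (\<lambda>k. g (y + s *\<^sub>R v) \<bullet> k)) (at (y + s *\<^sub>R v) within C)"
      using smooth seg[OF s] by (auto simp: L_smooth_on_def has_gradient_on_def)
    \<comment> \<open>The chain rule asks for a derivative within the image of the segment;
      convexity puts that image inside \<open>C\<close>.\<close>
    then have F': "(F has_derivative (\<lambda>k. g (y + s *\<^sub>R v) \<bullet> k))
        (at (y + s *\<^sub>R v) within (\<lambda>s. y + s *\<^sub>R v) ` {0..1})"
      by (rule has_derivative_subset) (use seg in auto)
    have "((\<lambda>s. y + s *\<^sub>R v) has_derivative (\<lambda>k. k *\<^sub>R v)) (at s within {0..1})"
      by (auto intro!: derivative_eq_intros)
    from has_derivative_in_compose[OF this F']
    have "((\<lambda>s. F (y + s *\<^sub>R v)) has_real_derivative g (y + s *\<^sub>R v) \<bullet> v) (at s within {0..1})"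
      by (simp add: has_field_derivative_def mult_commute_abs)
    then show ?thesis
      unfolding h_def h'_def by (auto intro!: derivative_eq_intros simp: algebra_simps)
  qed
  have nonneg: "0 \<le> h' s" if s: "s \<in> {0..1}" for s
  proof -
    \<comment> \<open>The two points are \<open>s * norm v\<close> apart. By Cauchy-Schwarz, the
      change of the gradient along \<open>v\<close> is then outweighed by the derivative
      \<open>L * s * (norm v)\<^sup>2\<close> of the quadratic term.\<close>
    have "norm (g (y + s *\<^sub>R v) - g y) \<le> L * (s * norm v)"
    proof -
      have "norm (g (y + s *\<^sub>R v) - g y) \<le> L * norm (y + s *\<^sub>R v - y)"
        using smooth seg[OF s] y unfolding L_smooth_on_def by blast
      then show ?thesis using s by simp
    qed
    from mult_right_mono[OF this norm_ge_zero[of v]]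
    have "norm (g (y + s *\<^sub>R v) - g y) * norm v \<le> L * s * (norm v)\<^sup>2"
      by (simp add: power2_eq_square mult.assoc)
    moreover have "- ((g (y + s *\<^sub>R v) - g y) \<bullet> v) \<le> norm (g (y + s *\<^sub>R v) - g y) * norm v"
      using Cauchy_Schwarz_ineq2[of "g (y + s *\<^sub>R v) - g y" v] by linarith
    ultimately show ?thesis by (simp add: h'_def inner_diff_left)
  qed
  have "h 0 \<le> h 1"
    by (rule nondecreasing_if_deriv_nonneg_within[of 0 1 h h']) (use deriv nonneg in auto)
  then show ?thesis by (simp add: h_def v_def)
qed

(* L may be negative only if C is a singleton; then D = 0 and u = 0. *)
lemma L_smooth_on_diameter_bound:
  fixes F :: "'a::real_inner \<Rightarrow> real"
  assumes "is_max D {(norm (y - z))\<^sup>2 | y z. y \<in> C \<and> z \<in> C}"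
    and "L_smooth_on L F g C" and u: "(norm u)\<^sup>2 \<le> D"
  shows "L * (norm u)\<^sup>2 \<le> L * D"
proof -
  \<comment> \<open>A pair attaining the maximum: if its points differ, the Lipschitz bound between
    them forces \<open>0 \<le> L\<close>.\<close>
  obtain y z where yz: "y \<in> C" "z \<in> C" "D = (norm (y - z))\<^sup>2"
    using assms(1) by (auto simp: is_max_def)
  have "norm (g y - g z) \<le> L * norm (y - z)"
    using assms(2) yz unfolding L_smooth_on_def by blast
  then have "0 \<le> L * norm (y - z)"
    using norm_ge_zero[of "g y - g z"] by linarith
  then show ?thesis
    using u yz by (cases "y = z") (simp_all add: zero_le_mult_iff mult_left_mono)
qed

theorem mainTheorem2:
  fixes C :: "(real ^ 'n) set"
    and F :: "real ^ 'n \<Rightarrow> real"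
    and gradF :: "real ^ 'n \<Rightarrow> real ^ 'n"
    and xstar :: "real ^ 'n"
    and D L T :: real
    and a b a' b' :: "real \<Rightarrow> real"
    and N :: nat
    and t :: "nat \<Rightarrow> real"
    and x :: "real \<Rightarrow> real ^ 'n"
    and c d G :: "nat \<Rightarrow> real"
    and u :: "nat \<Rightarrow> real ^ 'n"
  assumes "convex C"
    and "is_max D {(norm (y - z))\<^sup>2 | y z. y \<in> C \<and> z \<in> C}"
    and "\<forall>y\<in>C. 0 \<le> F y"
    and "has_gradient_on F gradF C"
    and "L_smooth_on L F gradF C"
    and "is_arg_max F (\<lambda>y. y \<in> C) xstar"
    and "0 < T"
    and "\<forall>s\<in>{0..T}. (a has_real_derivative a' s) (at s within {0..T})"
    and "\<forall>s\<in>{0..T}. (b has_real_derivative b' s) (at s within {0..T})"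
    and "0 < a 0"
    and "\<forall>s\<in>{0..T}. 0 \<le> a' s"
    and "0 \<le> b 0"
    and "\<forall>s\<in>{0..T}. 0 \<le> b' s"
    and "t 0 = 0"
    and "\<forall>j<N. t j < t (Suc j)"
    and "t N = T"
    and "\<forall>j\<le>N. x (t j) \<in> C"
    and "\<forall>j<N. 0 < c j"
    and "\<forall>j<N. (norm (u j))\<^sup>2 \<le> D"
    and "\<forall>j<N. F xstar \<le> c j * F (x (t j)) + d j * (gradF (x (t j)) \<bullet> u j)"
    and "\<forall>j<N. x (t (Suc j)) - x (t j)
           = ((b (t (Suc j)) - b (t j)) / a (t (Suc j)) * d j) *\<^sub>R u j"
    and "\<forall>j<N. G j = c j * (b (t (Suc j)) - b (t j)) - (a (t (Suc j)) - a (t j))"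
  shows "F (x (t N)) \<ge>
      ((b (t N) - b (t 0) - (\<Sum>j<N. max (G j) 0)) / a (t N)) * F xstar
      - D * L / (2 * a (t N)) *
          (\<Sum>j<N. (b (t (Suc j)) - b (t j))\<^sup>2 * (d j)\<^sup>2 / a (t (Suc j)))"
proof -
  define A B where "A j = a (t j)" and "B j = b (t j)" for j
  define X where "X j = x (t j)" for j
  define E where "E j = (B (Suc j) - B j)\<^sup>2 * (d j)\<^sup>2 / A (Suc j)" for j
  have t_less: "t j < t (Suc j)" if "j < N" for j using assms(15) that by blast
  \<comment> \<open>Keeps all grid points in \<open>{0..T}\<close>, the only place where
    \<open>a\<close> and \<open>b\<close> are known to be monotone.\<close>
  have t_mono: "t i \<le> t j" if "i \<le> j" "j \<le> N" for i j
    using that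
  proof (induction rule: dec_induct)
    case (step k)
    then show ?case using t_less[of k] by simp
  qed simp
  have t_mem: "t j \<in> {0..T}" if "j \<le> N" for j
    using t_mono[of 0 j] t_mono[of j N] that assms(14,16) by auto
  have a_mono: "a r \<le> a s" if "r \<in> {0..T}" "s \<in> {0..T}" "r \<le> s" for r s
    by (rule nondecreasing_if_deriv_nonneg_within[of 0 T a a']) (use assms(8,11) that in auto)
  have b_mono: "b r \<le> b s" if "r \<in> {0..T}" "s \<in> {0..T}" "r \<le> s" for r s
    by (rule nondecreasing_if_deriv_nonneg_within[of 0 T b b']) (use assms(9,13) that in auto)
  have A_pos: "0 < A j" if "j \<le> N" for j
    using a_mono[of 0 "t j"] t_mem[OF that] assms(7,10) by (auto simp: A_def)
  have X_mem: "X j \<in> C" if "j \<le> N" for j using assms(17) that by (simp add: X_def)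
  have F_nonneg: "0 \<le> F (X j)" if "j \<le> N" for j using assms(3) X_mem[OF that] by blast
  have F_le: "F (X j) \<le> F xstar" if "j \<le> N" for j
    using assms(6) X_mem[OF that] by (auto simp: is_arg_max_linorder)
  \<comment> \<open>The smoothness bound is scaled by the new weight \<open>A (Suc j)\<close>, which
    cancels the denominator of the update.\<close>
  have step: "(B (Suc j) - B j - max (G j) 0) * F xstar - D * L / 2 * E j
      \<le> A (Suc j) * F (X (Suc j)) - A j * F (X j)" if j: "j < N" for j
  proof -
    define \<beta> where "\<beta> = B (Suc j) - B j"
    define A1 where "A1 = A (Suc j)"
    have A1: "0 < A1" using A_pos j by (simp add: A1_def)
    have \<beta>: "0 \<le> \<beta>"
      using b_mono[of "t j" "t (Suc j)"] t_mem[of j] t_mem[of "Suc j"] t_less[OF j] j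
      by (auto simp: \<beta>_def B_def)
    have diff: "X (Suc j) - X j = (\<beta> / A1 * d j) *\<^sub>R u j"
      using assms(21) j by (simp add: X_def \<beta>_def B_def A1_def A_def)
    have "L * (norm (u j))\<^sup>2 \<le> L * D"
      by (rule L_smooth_on_diameter_bound[OF assms(2,5)]) (use assms(19) j in blast)
    then have "(L * (norm (u j))\<^sup>2) * ((\<beta> * d j)\<^sup>2 / A1 / 2) \<le> (L * D) * ((\<beta> * d j)\<^sup>2 / A1 / 2)"
      using A1 by (intro mult_right_mono) auto
    \<comment> \<open>The squared update carries \<open>A1\<close> twice in the denominator; the
      scaling leaves one, as in \<open>E j\<close>.\<close>
    moreover have "A1 * (L / 2 * (norm (X (Suc j) - X j))\<^sup>2)
        = (L * (norm (u j))\<^sup>2) * ((\<beta> * d j)\<^sup>2 / A1 / 2)"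
      using A1 by (simp add: diff field_simps power2_eq_square)
    moreover have "(L * D) * ((\<beta> * d j)\<^sup>2 / A1 / 2) = D * L / 2 * E j"
      by (simp add: E_def \<beta>_def A1_def power_mult_distrib mult_ac)
    ultimately have err: "A1 * (L / 2 * (norm (X (Suc j) - X j))\<^sup>2) \<le> D * L / 2 * E j"
      by linarith
    have "A1 * (F (X j) + gradF (X j) \<bullet> (X (Suc j) - X j) - L / 2 * (norm (X (Suc j) - X j))\<^sup>2)
        \<le> A1 * F (X (Suc j))"
      using L_smooth_on_lower_bound[OF assms(1,5) X_mem X_mem, of j "Suc j"] j A1
      by (intro mult_left_mono) auto
    moreover have "A1 * (gradF (X j) \<bullet> (X (Suc j) - X j)) = \<beta> * (d j * (gradF (X j) \<bullet> u j))"
      using A1 by (simp add: diff)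
    \<comment> \<open>Hypothesis (i) times \<open>\<beta> \<ge> 0\<close>. The factor
      \<open>d j\<close>, of either sign, stays with the inner product.\<close>
    moreover have "\<beta> * (F xstar - c j * F (X j)) \<le> \<beta> * (d j * (gradF (X j) \<bullet> u j))"
      using assms(20) j \<beta> by (intro mult_left_mono) (auto simp: X_def algebra_simps)
    ultimately have 1: "A1 * F (X j) + \<beta> * (F xstar - c j * F (X j)) - D * L / 2 * E j
        \<le> A1 * F (X (Suc j))"
      using err by (simp add: algebra_simps)
    have "G j * F (X j) \<le> max (G j) 0 * F (X j)"
      using F_nonneg j by (intro mult_right_mono) auto
    also have "\<dots> \<le> max (G j) 0 * F xstar"
      using F_le j by (intro mult_left_mono) auto
    finally have 2: "G j * F (X j) \<le> max (G j) 0 * F xstar" .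
    \<comment> \<open>Subtracting \<open>A j * F (X j)\<close> from both sides of \<open>1\<close>
      leaves exactly \<open>- G j\<close> as the coefficient of \<open>F (X j)\<close> on the
      left.\<close>
    have "G j * F (X j) = (c j * \<beta> - (A1 - A j)) * F (X j)"
      using assms(22) j by (simp add: \<beta>_def B_def A1_def A_def)
    with 1 2 show ?thesis
      unfolding \<beta>_def[symmetric] A1_def[symmetric] by (simp only: algebra_simps)
  qed
  have "(\<Sum>j<N. (B (Suc j) - B j - max (G j) 0) * F xstar - D * L / 2 * E j)
      \<le> (\<Sum>j<N. A (Suc j) * F (X (Suc j)) - A j * F (X j))"
    by (intro sum_mono step) simp
  also have "\<dots> = A N * F (X N) - A 0 * F (X 0)"
    by (rule sum_lessThan_telescope)
  \<comment> \<open>The initial term is dropped, since \<open>A 0\<close> is positive and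
    \<open>F\<close> is non-negative on \<open>C\<close>.\<close>
  also have "\<dots> \<le> A N * F (X N)"
    using A_pos[of 0] F_nonneg[of 0] by simp
  \<comment> \<open>This equation rewrites the left end of the chain; the increments of
    \<open>B\<close> telescope.\<close>
  also have "(\<Sum>j<N. (B (Suc j) - B j - max (G j) 0) * F xstar - D * L / 2 * E j)
      = (B N - B 0 - (\<Sum>j<N. max (G j) 0)) * F xstar - D * L / 2 * (\<Sum>j<N. E j)"
    by (simp only: sum_subtractf sum_distrib_left[symmetric] sum_distrib_right[symmetric]
        sum_lessThan_telescope[of B N, symmetric])
  finally have "((B N - B 0 - (\<Sum>j<N. max (G j) 0)) * F xstar - D * L / 2 * (\<Sum>j<N. E j)) / A N
      \<le> F (X N)"
    using A_pos[of N] by (simp add: pos_divide_le_eq mult.commute)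
  then show ?thesis
    by (simp add: A_def B_def E_def X_def diff_divide_distrib[of "_ * F xstar"])
qed

end
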